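(* Fix a prime power $q$. For each $n\geq 1$ let $\pi_n$ be a random set partition of $[n]$ distributed according to the superplancherel measure $\mathrm{SPl}_n$ (all $\pi_n$ being defined on a common probability space). Then $$\frac{\dim(\pi_n)}{n^2}\to\frac14\ \text{ almost surely},\qquad \mathrm{crs}(\pi_n)\in O_P(n^2).$$
   Context: Set partitions. $[n]=\{1,\dots,n\}$; $\pi\vdash[n]$ means that $\pi$ is a set partition of $[n]$. A pair $(i,j)$ with $i<j$ is an arc of $\pi$ if $i,j$ lie in the same block of $\pi$ and no $k$ with $i<k<j$ lies in that block. $D(\pi)$ is the set of arcs, $d(\pi)=|D(\pi)|$, $\dim(\pi)=\sum_{(i,j)\in D(\pi)}(j-i)$, and $\mathrm{crs}(\pi)$ is the number of crossings, i.e. unordered pairs of arcs $\{(i,j),(k,l)\}\subseteq D(\pi)$ with $i<k<j<l$. Superplancherel measure. Let $U_n$ be the group of $n\times n$ upper unitriangular matrices over the field with $q$ elements, $|U_n|=q^{n(n-1)/2}$. In the supercharacter theory of $U_n$ due to Bergeron and Thiem, the supercharacters $\chi^\pi$ are indexed by $\pi\vdash[n]$ and satisfy $\chi^\pi(1)=(q-1)^{d(\pi)}q^{\dim(\pi)-d(\pi)}$ and $\langle\chi^\pi,\chi^\pi\rangle=(q-1)^{d(\pi)}q^{\mathrm{crs}(\pi)}$. The superplancherel measure is the probability measure on set partitions of $[n]$ given by $$\mathrm{SPl}_n(\pi)=\frac{1}{|U_n|}\frac{\chi^\pi(1)^2}{\langle\chi^\pi,\chi^\pi\rangle}=\frac{1}{q^{n(n-1)/2}}\,\frac{(q-1)^{d(\pi)}q^{2\dim(\pi)-2d(\pi)}}{q^{\mathrm{crs}(\pi)}}.$$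 For random variables $X_n$, $X_n\in O_P(n^2)$ means: for every $\varepsilon>0$ there is $M>0$ such that $P(|X_n|>Mn^2)\le\varepsilon$ for all $n$. *)

theory Defs
  imports
    "HOL-Probability.Probability"
    "HOL-Number_Theory.Prime_Powers"
begin

definition set_partitions :: "nat \<Rightarrow> nat set set set" where
  "set_partitions n = {\<pi>. partition_on {1..n} \<pi>}"

definition arcs :: "nat set set \<Rightarrow> (nat \<times> nat) set" where
  "arcs \<pi> = {(i, j). i < j \<and> (\<exists>B\<in>\<pi>. i \<in> B \<and> j \<in> B \<and> \<not> (\<exists>k\<in>B. i < k \<and> k < j))}"

definition num_arcs :: "nat set set \<Rightarrow> nat" where
  "num_arcs \<pi> = card (arcs \<pi>)"

definition partition_dim :: "nat set set \<Rightarrow> nat" where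
  "partition_dim \<pi> = (\<Sum>(i, j)\<in>arcs \<pi>. j - i)"

text \<open>Crossings are unordered pairs of arcs, hence a set of two-element sets.\<close>

definition crossings :: "nat set set \<Rightarrow> (nat \<times> nat) set set" where
  "crossings \<pi> =
     {{(i, j), (k, l)} | i j k l. {(i, j), (k, l)} \<subseteq> arcs \<pi> \<and> i < k \<and> k < j \<and> j < l}"

definition crs :: "nat set set \<Rightarrow> nat" where
  "crs \<pi> = card (crossings \<pi>)"

text \<open>
  The mass of \<open>\<pi>\<close> is \<open>\<chi>(1)\<^sup>2 / (|U| \<langle>\<chi>, \<chi>\<rangle>)\<close>, where \<open>\<chi>\<close> is the Bergeron--Thiem supercharacter
  indexed by \<open>\<pi>\<close> of the group \<open>U\<close> of upper unitriangular \<open>n \<times> n\<close> matrices over the field with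
  \<open>q\<close> elements. Writing \<open>d\<close> for the number of arcs,
  \<open>\<chi>(1) = (q - 1)\<^sup>d q\<^bsup>dim - d\<^esup>\<close>, \<open>\<langle>\<chi>, \<chi>\<rangle> = (q - 1)\<^sup>d q\<^bsup>crs\<^esup>\<close> and \<open>|U| = q\<^bsup>n(n-1)/2\<^esup>\<close>.
  Every arc \<open>(i, j)\<close> contributes \<open>j - i \<ge> 1\<close> to the dimension, so the subtraction in the
  exponent is never truncated.
\<close>

definition SPl :: "nat \<Rightarrow> nat \<Rightarrow> nat set set \<Rightarrow> real" where
  "SPl q n \<pi> =
     1 / real q ^ (n * (n - 1) div 2) *
     ((real q - 1) ^ num_arcs \<pi> * real q ^ (2 * partition_dim \<pi> - 2 * num_arcs \<pi>)
       / real q ^ crs \<pi>)"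

definition superplancherel :: "nat \<Rightarrow> nat \<Rightarrow> nat set set measure" where
  "superplancherel q n = point_measure (set_partitions n) (\<lambda>\<pi>. ennreal (SPl q n \<pi>))"

text \<open>\<open>X\<^sub>n \<in> O\<^sub>P(r\<^sub>n)\<close> for a sequence indexed by \<open>n \<ge> 1\<close>.\<close>

definition bigO_P :: "'a measure \<Rightarrow> (nat \<Rightarrow> 'a \<Rightarrow> real) \<Rightarrow> (nat \<Rightarrow> real) \<Rightarrow> bool" where
  "bigO_P M X r \<longleftrightarrow>
     (\<forall>\<epsilon>>0. \<exists>C>0. \<forall>n\<ge>1. measure M {\<omega> \<in> space M. \<bar>X n \<omega>\<bar> > C * r n} \<le> \<epsilon>)"

end

theory Submission
  imports Defs "HOL-Real_Asymp.Real_Asymp"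
begin

text \<open>
  Either endpoint of an arc determines the arc, so comparing the endpoints with \<open>(n + 1) / 2\<close> shows
  that \<open>dim(\<pi>) \<le> n\<^sup>2 / 4\<close> for every partition, and \<open>crs(\<pi>) \<le> n\<^sup>2\<close> because there are at most
  \<open>n\<close> arcs. A partition with \<open>dim(\<pi>) < (1/4 - \<epsilon>) n\<^sup>2\<close> has mass at most \<open>q\<^bsup>n/2 - 2\<epsilon>n\<^sup>2\<^esup>\<close>. As there are
  at most \<open>n\<^sup>n\<close> partitions, the probability of such a deviation is summable in \<open>n\<close>, and the
  Borel--Cantelli lemma applies.
\<close>

section \<open>Arcs and deterministic bounds on dimension and crossings\<close>

lemma arcs_subset:
  assumes "\<pi> \<in> set_partitions n"
  shows "arcs \<pi> \<subseteq> {1..n} \<times> {1..n}"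
  using assms by (auto simp: arcs_def set_partitions_def partition_on_def)

lemma finite_arcs: "\<pi> \<in> set_partitions n \<Longrightarrow> finite (arcs \<pi>)"
  by (rule finite_subset[OF arcs_subset]) auto

lemma set_partitions_block_unique:
  assumes "\<pi> \<in> set_partitions n" "B \<in> \<pi>" "C \<in> \<pi>" "x \<in> B" "x \<in> C"
  shows "B = C"
  using assms by (auto simp: set_partitions_def partition_on_def disjoint_def)

text \<open>An arc from \<open>i\<close> ends at the successor of \<open>i\<close> in its block: of
  two arcs from \<open>i\<close>, the shorter would end strictly inside the longer.\<close>

lemma inj_on_fst_arcs:
  assumes "\<pi> \<in> set_partitions n"
  shows "inj_on fst (arcs \<pi>)"
proof (rule inj_onI, clarsimp)
  fix i j j' assume "(i, j) \<in> arcs \<pi>" "(i, j') \<in> arcs \<pi>"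
  then show "j = j'"
    unfolding arcs_def using set_partitions_block_unique[OF assms, of _ _ i]
    by (smt (verit) mem_Collect_eq case_prodD linorder_neqE_nat)
qed

lemma inj_on_snd_arcs:
  assumes "\<pi> \<in> set_partitions n"
  shows "inj_on snd (arcs \<pi>)"
proof (rule inj_onI, clarsimp)
  fix i i' j assume "(i, j) \<in> arcs \<pi>" "(i', j) \<in> arcs \<pi>"
  then show "i = i'"
    unfolding arcs_def using set_partitions_block_unique[OF assms, of _ _ j]
    by (smt (verit) mem_Collect_eq case_prodD linorder_neqE_nat)
qed

lemma num_arcs_le:
  assumes "\<pi> \<in> set_partitions n"
  shows "num_arcs \<pi> \<le> n"
proof -
  have "card (arcs \<pi>) = card (fst ` arcs \<pi>)"
    by (simp add: card_image inj_on_fst_arcs[OF assms])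
  also have "\<dots> \<le> card {1..n}"
    using arcs_subset[OF assms] by (intro card_mono) auto
  finally show ?thesis by (simp add: num_arcs_def)
qed

lemma crs_le:
  assumes "\<pi> \<in> set_partitions n"
  shows "crs \<pi> \<le> n\<^sup>2"
proof -
  have fin: "finite (arcs \<pi>)" by (rule finite_arcs[OF assms])
  \<comment> \<open>Passing from ordered to unordered pairs only merges elements, so the square of
    the number of arcs is a sufficient bound.\<close>
  have "crossings \<pi> \<subseteq> (\<lambda>(a, b). {a, b}) ` (arcs \<pi> \<times> arcs \<pi>)"
    unfolding crossings_def by (auto intro!: image_eqI)
  then have "crs \<pi> \<le> card ((\<lambda>(a, b). {a, b}) ` (arcs \<pi> \<times> arcs \<pi>))"
    unfolding crs_def using fin by (intro card_mono) auto
  also have "\<dots> \<le> card (arcs \<pi> \<times> arcs \<pi>)"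
    using fin by (intro card_image_le) auto
  also have "\<dots> = num_arcs \<pi> * num_arcs \<pi>"
    by (simp add: card_cartesian_product num_arcs_def)
  also have "\<dots> \<le> n\<^sup>2"
    unfolding power2_eq_square using num_arcs_le[OF assms] by (intro mult_mono) auto
  finally show ?thesis .
qed

text \<open>Induction in steps of two: from n to n + 2, the two outermost terms each equal n + 1 and
  the inner ones are the old terms shifted by one. The gain 2(n + 1) is exactly the growth of half
  the square.\<close>

lemma sum_abs_centered_le:
  "(\<Sum>m=1..n. \<bar>2 * real m - (real n + 1)\<bar>) \<le> (real n)\<^sup>2 / 2"
proof (induction n rule: induct_nat_012)
  case 0
  show ?case by simp
next
  case 1
  show ?case by simp
next
  case (ge2 n)
  have "(\<Sum>m=1..Suc (Suc n). \<bar>2 * real m - (real (Suc (Suc n)) + 1)\<bar>)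
      = (\<Sum>m=1..Suc n. \<bar>2 * real m - (real n + 3)\<bar>) + (real n + 1)"
    by (simp add: algebra_simps)
  also have "(\<Sum>m=1..Suc n. \<bar>2 * real m - (real n + 3)\<bar>)
      = (real n + 1) + (\<Sum>m=Suc 1..Suc n. \<bar>2 * real m - (real n + 3)\<bar>)"
    by (subst sum.atLeast_Suc_atMost) auto
  also have "(\<Sum>m=Suc 1..Suc n. \<bar>2 * real m - (real n + 3)\<bar>)
      = (\<Sum>m=1..n. \<bar>2 * real m - (real n + 1)\<bar>)"
    by (subst sum.atLeast_Suc_atMost_Suc_shift) (simp add: algebra_simps)
  finally show ?case
    using ge2.IH(1) by (simp add: power2_eq_square field_simps)
qed

lemma partition_dim_le:
  assumes "\<pi> \<in> set_partitions n"
  shows "real (partition_dim \<pi>) \<le> (real n)\<^sup>2 / 4"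
proof -
  define g where "g m = 2 * real m - (real n + 1)" for m
  have sub: "arcs \<pi> \<subseteq> {1..n} \<times> {1..n}" by (rule arcs_subset[OF assms])
  \<comment> \<open>Centering costs nothing, since the constant n + 1 cancels in each arc.\<close>
  have "2 * real (partition_dim \<pi>) = (\<Sum>a\<in>arcs \<pi>. g (snd a) - g (fst a))"
    unfolding partition_dim_def of_nat_sum sum_distrib_left
    by (intro sum.cong) (auto simp: arcs_def g_def of_nat_diff)
  also have "\<dots> \<le> (\<Sum>a\<in>arcs \<pi>. max 0 (g (snd a)) + max 0 (- g (fst a)))"
    by (intro sum_mono) auto
  \<comment> \<open>By injectivity each point is counted at most once as a right and once as a left
    endpoint. The summands are nonnegative, so both sums may then be extended to all of [n], where
    the two parts add up to the absolute value.\<close>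
  also have "\<dots> = (\<Sum>j\<in>snd ` arcs \<pi>. max 0 (g j)) + (\<Sum>i\<in>fst ` arcs \<pi>. max 0 (- g i))"
    by (simp add: sum.distrib sum.reindex inj_on_fst_arcs[OF assms] inj_on_snd_arcs[OF assms])
  also have "\<dots> \<le> (\<Sum>j=1..n. max 0 (g j)) + (\<Sum>i=1..n. max 0 (- g i))"
    using sub by (intro add_mono sum_mono2) auto
  also have "\<dots> = (\<Sum>m=1..n. \<bar>g m\<bar>)"
    unfolding sum.distrib[symmetric] by (intro sum.cong) auto
  also have "\<dots> \<le> (real n)\<^sup>2 / 2"
    unfolding g_def by (rule sum_abs_centered_le)
  finally show ?thesis by simp
qed

section \<open>Counting set partitions\<close>

text \<open>A partition consists of the fibres of the map sending each point to the least element of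
  its block. Covering by self-maps of [n] yields both finiteness and the bound n^n.\<close>

lemma set_partitions_subset_fibres:
  "set_partitions n \<subseteq>
     (\<lambda>f. (\<lambda>y. {x \<in> {1..n}. f x = y}) ` f ` {1..n}) ` ({1..n} \<rightarrow>\<^sub>E {1..n})"
proof
  fix \<pi> assume \<pi>: "\<pi> \<in> set_partitions n"
  then have un: "\<Union>\<pi> = {1..n}" and ne: "{} \<notin> \<pi>"
    by (auto simp: set_partitions_def partition_on_def)
  then have "\<forall>x\<in>{1..n}. \<exists>B\<in>\<pi>. x \<in> B" by blast
  then obtain B where B: "\<And>x. x \<in> {1..n} \<Longrightarrow> B x \<in> \<pi> \<and> x \<in> B x" by metis
  have B_eq: "B x = C" if "C \<in> \<pi>" "x \<in> C" for x C
  proof -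
    have "x \<in> {1..n}" using that un by blast
    then show ?thesis
      using B set_partitions_block_unique[OF \<pi>] that by blast
  qed
  have Min_in: "Min C \<in> C" if "C \<in> \<pi>" for C
  proof (rule Min_in)
    show "finite C" using un that by (metis Sup_upper finite_atLeastAtMost finite_subset)
    show "C \<noteq> {}" using ne that by blast
  qed
  define f where "f = restrict (\<lambda>x. Min (B x)) {1..n}"
  have fibre: "{y \<in> {1..n}. f y = f x} = B x" if "x \<in> {1..n}" for x
  proof (intro equalityI subsetI)
    fix y assume "y \<in> {y \<in> {1..n}. f y = f x}"
    then have y: "y \<in> {1..n}" and "Min (B y) = Min (B x)"
      using that by (auto simp: f_def)
    \<comment> \<open>The common minimum belongs to both blocks, so they coincide.\<close>
    then have "B y = B x"
      using Min_in B that set_partitions_block_unique[OF \<pi>] by metis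
    then show "y \<in> B x" using B[OF y] by simp
  next
    fix y assume y: "y \<in> B x"
    then have "y \<in> {1..n}" "B y = B x"
      using B[OF that] un B_eq by blast+
    then show "y \<in> {y \<in> {1..n}. f y = f x}"
      using that by (simp add: f_def)
  qed
  have "(\<lambda>y. {x \<in> {1..n}. f x = y}) ` f ` {1..n} = B ` {1..n}"
    unfolding image_image using fibre by (intro image_cong) auto
  also have "\<dots> = \<pi>"
  proof (intro equalityI subsetI)
    fix C assume C: "C \<in> \<pi>"
    then have "B (Min C) = C" "Min C \<in> {1..n}"
      using Min_in B_eq un by blast+
    then show "C \<in> B ` {1..n}" by blast
  qed (use B in blast)
  finally have "\<pi> = (\<lambda>y. {x \<in> {1..n}. f x = y}) ` f ` {1..n}" by simp
  moreover have "f \<in> {1..n} \<rightarrow>\<^sub>E {1..n}"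
    unfolding f_def using B Min_in un by (auto simp del: atLeastAtMost_iff)
  ultimately show "\<pi> \<in> (\<lambda>f. (\<lambda>y. {x \<in> {1..n}. f x = y}) ` f ` {1..n}) ` ({1..n} \<rightarrow>\<^sub>E {1..n})"
    by (rule image_eqI)
qed

lemma finite_set_partitions: "finite (set_partitions n)"
  by (rule finite_subset[OF set_partitions_subset_fibres]) (auto intro!: finite_PiE)

lemma card_set_partitions_le: "card (set_partitions n) \<le> n ^ n"
proof -
  have "card (set_partitions n) \<le> card ({1..n} \<rightarrow>\<^sub>E {1..n})"
    by (rule surj_card_le[OF _ set_partitions_subset_fibres]) (auto intro!: finite_PiE)
  then show ?thesis by (simp add: card_PiE)
qed

section \<open>Mass estimates and the lower tail of the dimension\<close>

lemma SPl_nonneg: "q \<ge> 1 \<Longrightarrow> SPl q n \<pi> \<ge> 0"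
  by (simp add: SPl_def)

text \<open>The crossing factor is dropped and q - 1 is replaced by q, after which the powers of q
  combine to at most q^(2D). The real exponent in \<open>powr\<close> allows for negative
  values.\<close>

lemma SPl_le:
  assumes q: "q \<ge> 2" and \<pi>: "\<pi> \<in> set_partitions n"
  shows "SPl q n \<pi> \<le> real q powr (2 * real (partition_dim \<pi>) - real n * (real n - 1) / 2)"
proof -
  define d D where "d = num_arcs \<pi>" and "D = partition_dim \<pi>"
  \<comment> \<open>Every arc has length at least one. Hence 2D - 2d is not truncated and d + (2D -
    2d) is at most 2D.\<close>
  have "card (arcs \<pi>) = (\<Sum>a\<in>arcs \<pi>. 1)" by simp
  also have "\<dots> \<le> D"
    unfolding D_def partition_dim_def by (intro sum_mono) (auto simp: arcs_def)
  finally have dD: "d \<le> D" by (simp add: d_def num_arcs_def)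
  have half: "real (n * (n - 1) div 2) = real n * (real n - 1) / 2"
    by (cases n) (simp_all add: real_of_nat_div algebra_simps)
  have "(real q - 1) ^ d * real q ^ (2 * D - 2 * d) / real q ^ crs \<pi>
      \<le> (real q - 1) ^ d * real q ^ (2 * D - 2 * d)"
    using q by (simp add: field_simps mult_le_cancel_left1)
  also have "\<dots> \<le> real q ^ d * real q ^ (2 * D - 2 * d)"
    using q by (intro mult_right_mono power_mono) auto
  also have "\<dots> \<le> real q ^ (2 * D)"
    unfolding power_add[symmetric] using q dD by (intro power_increasing) auto
  finally have "SPl q n \<pi> \<le> 1 / real q ^ (n * (n - 1) div 2) * real q ^ (2 * D)"
    unfolding SPl_def d_def D_def using q by (intro mult_left_mono) auto
  also have "\<dots> = real q powr (real (2 * D) - real (n * (n - 1) div 2))"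
    using q by (simp add: powr_diff powr_realpow del: of_nat_mult)
  finally show ?thesis unfolding half by (simp add: D_def)
qed

text \<open>The logarithm of the n-th term is n ln n plus a linear term minus a positive multiple of
  n^2. The quadratic term wins, and a geometric series dominates.\<close>

lemma summable_deviation_bound:
  fixes \<epsilon> :: real
  assumes \<epsilon>: "\<epsilon> > 0" and q: "q \<ge> (2 :: nat)"
  shows "summable (\<lambda>n. real n ^ n * real q powr (real n / 2 - 2 * \<epsilon> * (real n)\<^sup>2))"
proof (rule summable_comparison_test_ev)
  define L where "L = ln (real q)"
  have L: "L > 0" using q by (simp add: L_def)
  have "\<forall>\<^sub>F n in sequentially.
      real n * ln (real n) + (real n / 2 - 2 * \<epsilon> * (real n)\<^sup>2) * L \<le> - real n"
    using \<epsilon> L by real_asymp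
  then show "\<forall>\<^sub>F n in sequentially.
      norm (real n ^ n * real q powr (real n / 2 - 2 * \<epsilon> * (real n)\<^sup>2)) \<le> exp (-1) ^ n"
    using eventually_gt_at_top[of 0]
  proof eventually_elim
    case (elim n)
    have "real n ^ n * real q powr (real n / 2 - 2 * \<epsilon> * (real n)\<^sup>2)
        = exp (real n * ln (real n) + (real n / 2 - 2 * \<epsilon> * (real n)\<^sup>2) * L)"
      using elim q by (simp add: exp_add exp_of_nat_mult powr_def L_def)
    also have "\<dots> \<le> exp (real n * (-1))" using elim by simp
    finally show ?case by (simp only: exp_of_nat_mult) simp
  qed
  show "summable (\<lambda>n. exp (-1 :: real) ^ n)" by (intro summable_geometric) simp
qed

lemma prob_dim_deviation_le:
  fixes X :: "'a \<Rightarrow> nat set set"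
  assumes q: "q \<ge> 2" and "prob_space M"
    and X: "X \<in> measurable M (count_space (set_partitions n))"
    and distr: "distr M (count_space (set_partitions n)) X = superplancherel q n"
  shows "measure M {\<omega> \<in> space M. real (partition_dim (X \<omega>)) < (1 / 4 - \<epsilon>) * (real n)\<^sup>2}
     \<le> real n ^ n * real q powr (real n / 2 - 2 * \<epsilon> * (real n)\<^sup>2)" (is "measure M ?E \<le> ?b")
proof -
  define S where
    "S = {p \<in> set_partitions n. real (partition_dim p) < (1 / 4 - \<epsilon>) * (real n)\<^sup>2}"
  have S: "S \<subseteq> set_partitions n" by (auto simp: S_def)
  \<comment> \<open>The event depends on \<open>X\<close> only through its value, so its probability
    is a finite sum of masses.\<close>
  have "?E = X -` S \<inter> space M"
    using measurable_space[OF X] by (auto simp: S_def)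
  then have "emeasure M ?E = emeasure (superplancherel q n) S"
    using emeasure_distr[OF X, of S] S by (simp add: distr)
  also have "\<dots> = ennreal (\<Sum>p\<in>S. SPl q n p)"
    unfolding superplancherel_def
    using q S SPl_nonneg
    by (simp add: emeasure_point_measure_finite finite_set_partitions sum_ennreal)
  finally have "measure M ?E = (\<Sum>p\<in>S. SPl q n p)"
    using q by (simp add: measure_def sum_nonneg SPl_nonneg)
  also have "\<dots> \<le> (\<Sum>p\<in>S. real q powr (real n / 2 - 2 * \<epsilon> * (real n)\<^sup>2))"
  proof (rule sum_mono)
    fix p assume p: "p \<in> S"
    then have "SPl q n p \<le> real q powr (2 * real (partition_dim p) - real n * (real n - 1) / 2)"
      using S q by (intro SPl_le) auto
    \<comment> \<open>The leading terms cancel: 2(1/4 - \<epsilon>)n^2 - n(n - 1)/2 = n/2 -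
      2\<epsilon>n^2.\<close>
    also have "\<dots> \<le> real q powr (real n / 2 - 2 * \<epsilon> * (real n)\<^sup>2)"
      using p q by (intro powr_mono) (auto simp: S_def power2_eq_square field_simps)
    finally show "SPl q n p \<le> real q powr (real n / 2 - 2 * \<epsilon> * (real n)\<^sup>2)" .
  qed
  also have "\<dots> = real (card S) * real q powr (real n / 2 - 2 * \<epsilon> * (real n)\<^sup>2)" by simp
  also have "\<dots> \<le> ?b"
  proof (rule mult_right_mono)
    have "card S \<le> n ^ n"
      using card_mono[OF finite_set_partitions S] card_set_partitions_le[of n] by simp
    then show "real (card S) \<le> real n ^ n"
      by (metis of_nat_le_iff of_nat_power)
  qed simp
  finally show ?thesis .
qed

theorem corollary1p2:
  fixes q :: nat
    and M :: "'a measure"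
    and \<pi> :: "nat \<Rightarrow> 'a \<Rightarrow> nat set set"
  assumes "primepow q"
    and "prob_space M"
    and "\<And>n. n \<ge> 1 \<Longrightarrow> \<pi> n \<in> measurable M (count_space (set_partitions n))"
    and "\<And>n. n \<ge> 1 \<Longrightarrow>
           distr M (count_space (set_partitions n)) (\<pi> n) = superplancherel q n"
  shows "(AE \<omega> in M.
            (\<lambda>n. real (partition_dim (\<pi> n \<omega>)) / (real n)\<^sup>2) \<longlonglongrightarrow> 1 / 4) \<and>
         bigO_P M (\<lambda>n \<omega>. real (crs (\<pi> n \<omega>))) (\<lambda>n. (real n)\<^sup>2)"
proof
  interpret prob_space M by fact
  have q: "q \<ge> 2" using primepow_gt_Suc_0[OF assms(1)] by simp
  have in_parts: "\<pi> n \<omega> \<in> set_partitions n" if "n \<ge> 1" "\<omega> \<in> space M" for n \<omega>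
    using measurable_space[OF assms(3)] that by simp

  \<comment> \<open>The index is shifted by one because the laws are prescribed for n at least 1
    only.\<close>
  define bad where "bad \<epsilon> n = {\<omega> \<in> space M.
      real (partition_dim (\<pi> (Suc n) \<omega>)) < (1 / 4 - \<epsilon>) * (real (Suc n))\<^sup>2}" for \<epsilon> n
  have bad_sets: "bad \<epsilon> n \<in> sets M" for \<epsilon> n
  proof -
    have "bad \<epsilon> n = \<pi> (Suc n) -` {p \<in> set_partitions (Suc n).
        real (partition_dim p) < (1 / 4 - \<epsilon>) * (real (Suc n))\<^sup>2} \<inter> space M"
      using in_parts by (auto simp: bad_def)
    also have "\<dots> \<in> sets M"
      by (rule measurable_sets[OF assms(3)]) auto
    finally show ?thesis .
  qed
  \<comment> \<open>The joint law of the partitions is unspecified; the first Borel-Cantelli lemma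
    works from the individual probabilities alone.\<close>
  have "AE \<omega> in M. \<forall>\<^sub>F n in sequentially. \<omega> \<in> space M - bad \<epsilon> n" if "\<epsilon> > 0" for \<epsilon>
  proof (rule borel_cantelli_AE1)
    show "bad \<epsilon> n \<in> sets M" for n by (rule bad_sets)
    show "emeasure M (bad \<epsilon> n) < \<infinity>" for n by (simp add: emeasure_eq_measure)
    let ?b = "\<lambda>n. real n ^ n * real q powr (real n / 2 - 2 * \<epsilon> * (real n)\<^sup>2)"
    show "summable (\<lambda>n. measure M (bad \<epsilon> n))"
    proof (rule summable_comparison_test')
      show "summable (\<lambda>n. ?b (Suc n))"
        using summable_deviation_bound[OF that q] by (subst summable_Suc_iff)
      show "norm (measure M (bad \<epsilon> n)) \<le> ?b (Suc n)" for n
        using prob_dim_deviation_le[OF q assms(2,3,4), of "Suc n" \<epsilon>]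
        by (simp add: bad_def del: of_nat_Suc)
    qed
  qed
  \<comment> \<open>Restricting to \<epsilon> = 1/(k + 1) leaves countably many exceptional null
    sets, which merge into one.\<close>
  then have "AE \<omega> in M. \<forall>k. \<forall>\<^sub>F n in sequentially. \<omega> \<in> space M - bad (1 / real (Suc k)) n"
    by (subst AE_all_countable) simp
  then show "AE \<omega> in M. (\<lambda>n. real (partition_dim (\<pi> n \<omega>)) / (real n)\<^sup>2) \<longlonglongrightarrow> 1 / 4"
  proof eventually_elim
    case (elim \<omega>)
    have \<omega>: "\<omega> \<in> space M"
      using elim eventually_happens'[OF sequentially_bot] by blast
    have "(\<lambda>n. real (partition_dim (\<pi> (Suc n) \<omega>)) / (real (Suc n))\<^sup>2) \<longlonglongrightarrow> 1 / 4"
    proof (rule order_tendstoI)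
      fix a :: real assume "a < 1 / 4"
      then obtain k where k: "1 / real (Suc k) < 1 / 4 - a"
        by (metis diff_gt_0_iff_gt nat_approx_posE)
      from elim have "\<forall>\<^sub>F n in sequentially. \<omega> \<in> space M - bad (1 / real (Suc k)) n" ..
      then show "\<forall>\<^sub>F n in sequentially.
          a < real (partition_dim (\<pi> (Suc n) \<omega>)) / (real (Suc n))\<^sup>2"
      proof eventually_elim
        case (elim n)
        have "a * (real (Suc n))\<^sup>2 < (1 / 4 - 1 / real (Suc k)) * (real (Suc n))\<^sup>2"
          using k by (intro mult_strict_right_mono) auto
        also have "\<dots> \<le> real (partition_dim (\<pi> (Suc n) \<omega>))"
          using elim by (auto simp: bad_def not_less)
        finally show ?case by (simp add: pos_less_divide_eq del: of_nat_Suc)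
      qed
    next
      fix a :: real assume a: "1 / 4 < a"
      \<comment> \<open>The upper half of the limit is deterministic and holds at every
        index.\<close>
      have "real (partition_dim (\<pi> (Suc n) \<omega>)) / (real (Suc n))\<^sup>2 \<le> 1 / 4" for n
        using partition_dim_le[OF in_parts[OF _ \<omega>, of "Suc n"]]
        by (simp add: pos_divide_le_eq del: of_nat_Suc)
      then show "\<forall>\<^sub>F n in sequentially.
          real (partition_dim (\<pi> (Suc n) \<omega>)) / (real (Suc n))\<^sup>2 < a"
        using a by (intro always_eventually allI) (rule le_less_trans)
    qed
    then show ?case by (rule LIMSEQ_imp_Suc)
  qed

  \<comment> \<open>The constant 1 serves every \<epsilon>, since the exceptional event is
    empty.\<close>
  have "{\<omega> \<in> space M. \<bar>real (crs (\<pi> n \<omega>))\<bar> > 1 * (real n)\<^sup>2} = {}" if "n \<ge> 1" for n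
  proof -
    have "real (crs (\<pi> n \<omega>)) \<le> (real n)\<^sup>2" if "\<omega> \<in> space M" for \<omega>
      using crs_le[OF in_parts[OF \<open>n \<ge> 1\<close> that]] by (metis of_nat_le_iff of_nat_power)
    then show ?thesis by (auto simp: not_less)
  qed
  then show "bigO_P M (\<lambda>n \<omega>. real (crs (\<pi> n \<omega>))) (\<lambda>n. (real n)\<^sup>2)"
    unfolding bigO_P_def
    by (intro allI impI exI[of _ 1] conjI zero_less_one) (simp only: measure_empty less_imp_le)
qed

end
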